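(* A complete bipartite preference structure $I=(M,W,\{\succ_m\}_{m\in M},\{\succ_w\}_{w\in W})$ of size four is cube-distance-compatible if and only if it has a perfect matching of mutually last-ranked pairs, i.e. there is a bijection $\pi:M\to W$ such that $(m,\pi(m))$ is a mutually last-ranked pair for every $m\in M$.
   Context: A complete bipartite preference structure of size $k$ is a tuple $I=(M,W,\{\succ_m\}_{m\in M},\{\succ_w\}_{w\in W})$, where $M$ and $W$ are disjoint finite sets with $|M|=|W|=k$, each $\succ_m$ is a strict total order on $W$, and each $\succ_w$ is a strict total order on $M$. The elements of $M\cup W$ are called agents; each agent ranks the agents of the opposite side by its order. The cube graph $Q_3$ has vertex set $\{0,1\}^3$, two vertices being adjacent if and only if they differ in exactly one coordinate. It is bipartite with two classes of size four (even-parity and odd-parity strings), and every vertex is adjacent to exactly three of the four vertices of the opposite class, so it has a unique non-neighbor in the opposite class. For $k=4$, a strong cube realization of $I$ consists of a graph isomorphic to $Q_3$ with bipartition classes $V_M,V_W$ (each of size four), together with bijections $M\to V_M$ and $W\to V_W$. The opposite-side non-neighbor of an agent is the agent of the other side placed at the unique non-adjacent vertex of the opposite class. A size-four complete bipartite preference structure is cube-distance-compatible if there is a strong cube realization such that, for every agent (in $M$ and in $W$), the unique opposite-side non-neighbor is ranked last by that agent. A pair $(m,w)\in M\times W$ is mutually last-ranked if $w$ is last in $m$'s preference order and $m$ is last in $w$'s preference order. *)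

theory Defs
  imports "Graph_Theory.Graph_Theory"
begin

section \<open>Complete bipartite preference structures\<close>

text \<open>
  Both sides live in one type of agents.  A preference order is a relation containing \<open>(x, y)\<close> iff
  \<open>x\<close> is strictly preferred to \<open>y\<close>; only the orders of \<open>men\<close> (in \<open>pref_m\<close>) and of \<open>women\<close>
  (in \<open>pref_w\<close>) are meaningful.
\<close>

record 'a preference_structure =
  men :: "'a set"
  women :: "'a set"
  pref_m :: "'a \<Rightarrow> 'a rel"
  pref_w :: "'a \<Rightarrow> 'a rel"

text \<open>
  The library's \<^const>\<open>strict_linear_order_on\<close> does not confine the relation to the given set, hence
  the separate inclusions.
\<close>

definition complete_bipartite_preference_structure :: "nat \<Rightarrow> 'a preference_structure \<Rightarrow> bool" where
  "complete_bipartite_preference_structure k I \<longleftrightarrow>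
     finite (men I) \<and> finite (women I) \<and> men I \<inter> women I = {} \<and>
     card (men I) = k \<and> card (women I) = k \<and>
     (\<forall>m\<in>men I. pref_m I m \<subseteq> women I \<times> women I \<and>
        strict_linear_order_on (women I) (pref_m I m)) \<and>
     (\<forall>w\<in>women I. pref_w I w \<subseteq> men I \<times> men I \<and>
        strict_linear_order_on (men I) (pref_w I w))"

definition ranked_last :: "'a set \<Rightarrow> 'a rel \<Rightarrow> 'a \<Rightarrow> bool" where
  "ranked_last A r x \<longleftrightarrow> x \<in> A \<and> (\<forall>y\<in>A. y \<noteq> x \<longrightarrow> (y, x) \<in> r)"

definition mutually_last_ranked :: "'a preference_structure \<Rightarrow> 'a \<Rightarrow> 'a \<Rightarrow> bool" where
  "mutually_last_ranked I m w \<longleftrightarrow>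
     m \<in> men I \<and> w \<in> women I \<and>
     ranked_last (women I) (pref_m I m) w \<and> ranked_last (men I) (pref_w I w) m"


section \<open>The cube graph and strong cube realizations\<close>

text \<open>
  Simple graphs are symmetric loop-free digraphs without parallel arcs; bit strings are Boolean lists.
\<close>

definition cube_graph :: "bool list pair_pre_digraph" where
  "cube_graph =
     \<lparr> pverts = {x. length x = 3},
       parcs = {(x, y). length x = 3 \<and> length y = 3 \<and> card {i. i < 3 \<and> x ! i \<noteq> y ! i} = 1} \<rparr>"

definition is_bipartition :: "'v pair_pre_digraph \<Rightarrow> 'v set \<Rightarrow> 'v set \<Rightarrow> bool" where
  "is_bipartition G A B \<longleftrightarrow>
     A \<union> B = pverts G \<and> A \<inter> B = {} \<and> parcs G \<subseteq> A \<times> B \<union> B \<times> A"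

text \<open>
  Symmetry, loop-freeness and finiteness of \<open>G\<close> follow from the isomorphism with the cube graph.
\<close>

definition strong_cube_realization ::
  "'a preference_structure \<Rightarrow> 'v pair_pre_digraph \<Rightarrow> 'v set \<Rightarrow> 'v set \<Rightarrow> ('a \<Rightarrow> 'v) \<Rightarrow> ('a \<Rightarrow> 'v) \<Rightarrow> bool"
where
  "strong_cube_realization I G V\<^sub>M V\<^sub>W \<alpha> \<beta> \<longleftrightarrow>
     digraph_iso (with_proj G) (with_proj cube_graph) \<and>
     is_bipartition G V\<^sub>M V\<^sub>W \<and> card V\<^sub>M = 4 \<and> card V\<^sub>W = 4 \<and>
     bij_betw \<alpha> (men I) V\<^sub>M \<and> bij_betw \<beta> (women I) V\<^sub>W"

text \<open>
  The agent of \<open>B\<close>, placed on the graph by \<open>g\<close>, whose vertex is not adjacent to the vertex \<open>v\<close> of the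
  opposite class.
\<close>

definition opposite_nonneighbor :: "'v pair_pre_digraph \<Rightarrow> ('a \<Rightarrow> 'v) \<Rightarrow> 'a set \<Rightarrow> 'v \<Rightarrow> 'a" where
  "opposite_nonneighbor G g B v = (THE b. b \<in> B \<and> (v, g b) \<notin> parcs G)"

definition nonneighbors_ranked_last ::
  "'a preference_structure \<Rightarrow> 'v pair_pre_digraph \<Rightarrow> ('a \<Rightarrow> 'v) \<Rightarrow> ('a \<Rightarrow> 'v) \<Rightarrow> bool" where
  "nonneighbors_ranked_last I G \<alpha> \<beta> \<longleftrightarrow>
     (\<forall>m\<in>men I. ranked_last (women I) (pref_m I m) (opposite_nonneighbor G \<beta> (women I) (\<alpha> m))) \<and>
     (\<forall>w\<in>women I. ranked_last (men I) (pref_w I w) (opposite_nonneighbor G \<alpha> (men I) (\<beta> w)))"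

text \<open>
  HOL cannot quantify over the vertex type, so the graph is taken with vertices in \<^typ>\<open>nat\<close>.  This
  loses nothing: see \<open>cube_distance_compatibleI\<close> below.
\<close>

definition cube_distance_compatible :: "'a preference_structure \<Rightarrow> bool" where
  "cube_distance_compatible I \<longleftrightarrow>
     (\<exists>(G :: nat pair_pre_digraph) V\<^sub>M V\<^sub>W \<alpha> \<beta>.
        strong_cube_realization I G V\<^sub>M V\<^sub>W \<alpha> \<beta> \<and> nonneighbors_ranked_last I G \<alpha> \<beta>)"


section \<open>Adequacy of the definitions\<close>

lemma finite_bool_lists: "finite {x :: bool list. length x = n}"
  using finite_lists_length_eq[of "UNIV :: bool set" n] by simp

lemma pair_graph_cube_graph: "pair_graph cube_graph"
proof
  show "finite (pverts cube_graph)"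
    by (simp add: cube_graph_def finite_bool_lists)
  show "finite (parcs cube_graph)"
    by (rule finite_subset[of _ "{x. length x = 3} \<times> {x. length x = 3}"])
      (auto simp: cube_graph_def finite_bool_lists)
  have *: "{i. i < 3 \<and> x ! i \<noteq> y ! i} = {i. i < 3 \<and> y ! i \<noteq> x ! i}" for x y :: "bool list"
    by auto
  show "symmetric (with_proj cube_graph)"
    unfolding symmetric_def
  proof (rule symI)
    fix x y assume "x \<rightarrow>\<^bsub>with_proj cube_graph\<^esub> y"
    then show "y \<rightarrow>\<^bsub>with_proj cube_graph\<^esub> x"
      using *[of x y] by (simp add: cube_graph_def)
  qed
qed (auto simp: cube_graph_def)

lemma digraph_iso_pairD:
  assumes "digraph_iso (with_proj G) (with_proj H)"
  obtains h where "bij_betw h (pverts G) (pverts H)"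
    and "parcs H = map_prod h h ` parcs G" and "parcs G \<subseteq> pverts G \<times> pverts G"
proof -
  obtain f where f: "pre_digraph.digraph_isomorphism (with_proj G) f"
    and H: "with_proj H = app_iso f (with_proj G)"
    using assms by (auto simp: digraph_iso_def)
  have HV: "pverts H = iso_verts f ` pverts G" and HA: "parcs H = iso_arcs f ` parcs G"
    and ht: "iso_tail f = fst" "iso_head f = snd"
    using arg_cong[OF H, of verts] arg_cong[OF H, of arcs] arg_cong[OF H, of tail]
      arg_cong[OF H, of head] by simp_all
  have wf: "wf_digraph (with_proj G)" and inj: "inj_on (iso_verts f) (pverts G)"
    and arcs: "\<forall>a\<in>parcs G. iso_verts f (fst a) = fst (iso_arcs f a) \<and>
                            iso_verts f (snd a) = snd (iso_arcs f a)"
    using f by (simp_all add: pre_digraph.digraph_isomorphism_def ht)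
  show thesis
  proof
    show "bij_betw (iso_verts f) (pverts G) (pverts H)"
      using inj HV by (simp add: bij_betw_def)
    have "iso_arcs f a = map_prod (iso_verts f) (iso_verts f) a" if "a \<in> parcs G" for a
      using arcs that by (auto simp: prod_eq_iff)
    then show "parcs H = map_prod (iso_verts f) (iso_verts f) ` parcs G"
      using HA by simp
    show "parcs G \<subseteq> pverts G \<times> pverts G"
      using wf_digraph.tail_in_verts[OF wf] wf_digraph.head_in_verts[OF wf]
      by (simp add: subset_iff mem_Times_iff)
  qed
qed

lemma digraph_iso_pairI:
  assumes "bij_betw h (pverts G) (pverts H)" "parcs H = map_prod h h ` parcs G"
    and "parcs G \<subseteq> pverts G \<times> pverts G"
  shows "digraph_iso (with_proj G) (with_proj H)"
proof -
  let ?f = "\<lparr> iso_verts = h, iso_arcs = map_prod h h, iso_head = snd, iso_tail = fst \<rparr>"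
  have inj: "inj_on h (pverts G)"
    using assms(1) by (simp add: bij_betw_def)
  have "wf_digraph (with_proj G)"
    by unfold_locales (use assms(3) in auto)
  moreover have "inj_on (map_prod h h) (parcs G)"
    by (rule inj_on_subset[OF map_prod_inj_on[OF inj inj] assms(3)])
  ultimately have "pre_digraph.digraph_isomorphism (with_proj G) ?f"
    using inj by (simp add: pre_digraph.digraph_isomorphism_def)
  moreover have "with_proj H = app_iso ?f (with_proj G)"
    using assms(1,2) by (simp add: app_iso_def with_proj_def bij_betw_def)
  ultimately show ?thesis
    unfolding digraph_iso_def by blast
qed

lemma cube_graph_degree:
  assumes "length x = 3"
  shows "card (parcs cube_graph `` {x}) = 3"
proof -
  obtain a b c where x: "x = [a, b, c]"
    using assms by (auto simp: numeral_3_eq_3 length_Suc_conv)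
  have *: "{i. i < 3 \<and> [a, b, c] ! i \<noteq> [a', b', c'] ! i} =
      (if a \<noteq> a' then {0} else {}) \<union> (if b \<noteq> b' then {1} else {}) \<union> (if c \<noteq> c' then {2} else {})"
    for a' b' c'
    by (auto simp: less_Suc_eq numeral_3_eq_3 numeral_2_eq_2)
  have "y \<in> parcs cube_graph `` {x} \<longleftrightarrow> y \<in> {[\<not> a, b, c], [a, \<not> b, c], [a, b, \<not> c]}" for y
  proof (cases "length y = 3")
    case True
    then obtain a' b' c' where y: "y = [a', b', c']"
      by (auto simp: numeral_3_eq_3 length_Suc_conv)
    have "(x, y) \<in> parcs cube_graph \<longleftrightarrow> card {i. i < 3 \<and> [a, b, c] ! i \<noteq> [a', b', c'] ! i} = 1"
      by (simp add: x y cube_graph_def)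
    also have "\<dots> \<longleftrightarrow> y \<in> {[\<not> a, b, c], [a, \<not> b, c], [a, b, \<not> c]}"
      unfolding * y by auto
    finally show ?thesis
      by simp
  qed (auto simp: cube_graph_def)
  then have "parcs cube_graph `` {x} = {[\<not> a, b, c], [a, \<not> b, c], [a, b, \<not> c]}"
    by blast
  then show ?thesis
    by simp
qed

text \<open>The definite description in \<^const>\<open>opposite_nonneighbor\<close> always denotes.\<close>

lemma ex1_nonneighbor:
  assumes iso: "digraph_iso (with_proj G) (with_proj cube_graph)"
    and bip: "is_bipartition G A B" and B: "card B = 4"
    and g: "bij_betw g W B" and v: "v \<in> A"
  shows "\<exists>!w. w \<in> W \<and> (v, g w) \<notin> parcs G"
proof -
  obtain h where h: "bij_betw h (pverts G) (pverts cube_graph)"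
    and arcs: "parcs cube_graph = map_prod h h ` parcs G" and wf: "parcs G \<subseteq> pverts G \<times> pverts G"
    using digraph_iso_pairD[OF iso] by metis
  have vG: "v \<in> pverts G"
    using v bip by (auto simp: is_bipartition_def)
  have inj: "inj_on h (pverts G)"
    using h by (simp add: bij_betw_def)
  have "parcs cube_graph `` {h v} = h ` (parcs G `` {v})"
  proof
    show "parcs cube_graph `` {h v} \<subseteq> h ` (parcs G `` {v})"
    proof
      fix y assume "y \<in> parcs cube_graph `` {h v}"
      then obtain a b where ab: "(a, b) \<in> parcs G" "h v = h a" "y = h b"
        by (auto simp: arcs)
      then have "v = a"
        using vG wf inj by (auto dest: inj_onD)
      then show "y \<in> h ` (parcs G `` {v})"
        using ab by auto
    qed
  qed (auto simp: arcs)
  moreover have "parcs G `` {v} \<subseteq> pverts G"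
    using wf by auto
  moreover have "length (h v) = 3"
    using h vG by (auto simp: cube_graph_def dest: bij_betwE)
  ultimately have "card (parcs G `` {v}) = 3"
    using cube_graph_degree[of "h v"] card_image[OF inj_on_subset[OF inj]] by metis
  moreover have "parcs G `` {v} \<subseteq> B"
    using bip v by (auto simp: is_bipartition_def)
  ultimately have "card (B - parcs G `` {v}) = 1"
    using B by (simp add: card_Diff_subset finite_subset card_ge_0_finite)
  then obtain b where b: "B - parcs G `` {v} = {b}"
    by (auto simp: card_1_singleton_iff)
  then have "b \<in> B"
    by blast
  then obtain w where w: "w \<in> W" "g w = b"
    using g by (auto simp: bij_betw_def)
  show ?thesis
  proof (rule ex1I[of _ w])
    show "w \<in> W \<and> (v, g w) \<notin> parcs G"
      using w b by blast
    fix w' assume w': "w' \<in> W \<and> (v, g w') \<notin> parcs G"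
    then have "g w' \<in> B"
      using g by (auto dest: bij_betwE)
    then have "g w' = g w"
      using w w' b by blast
    then show "w' = w"
      using w w' g by (auto simp: bij_betw_def dest: inj_onD)
  qed
qed

text \<open>Realizations by graphs on any other vertex type count as well.\<close>

lemma cube_distance_compatibleI:
  fixes G :: "'v pair_pre_digraph"
  assumes real: "strong_cube_realization I G V\<^sub>M V\<^sub>W \<alpha> \<beta>"
    and last: "nonneighbors_ranked_last I G \<alpha> \<beta>"
  shows "cube_distance_compatible I"
proof -
  have iso: "digraph_iso (with_proj G) (with_proj cube_graph)"
    and bip: "is_bipartition G V\<^sub>M V\<^sub>W"
    and c: "card V\<^sub>M = 4" "card V\<^sub>W = 4"
    and \<alpha>: "bij_betw \<alpha> (men I) V\<^sub>M" and \<beta>: "bij_betw \<beta> (women I) V\<^sub>W"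
    using real by (simp_all add: strong_cube_realization_def)
  obtain k where "bij_betw k (pverts G) (pverts cube_graph)" and wf: "parcs G \<subseteq> pverts G \<times> pverts G"
    using digraph_iso_pairD[OF iso] by metis
  then have "finite (pverts G)"
    using bij_betw_finite pair_fin_digraph.pair_finite_verts pair_graph.axioms(1)
      pair_digraph.axioms(1) pair_graph_cube_graph by blast
  then obtain h :: "'v \<Rightarrow> nat" where inj: "inj_on h (pverts G)"
    using finite_imp_inj_to_nat_seg[of "pverts G"] by metis
  define G' where "G' = \<lparr> pverts = h ` pverts G, parcs = map_prod h h ` parcs G \<rparr>"
  have "digraph_iso (with_proj G) (with_proj G')"
    by (rule digraph_iso_pairI[of h]) (use inj wf in \<open>auto simp: G'_def bij_betw_def\<close>)
  moreover have "wf_digraph (with_proj G)"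
    by unfold_locales (use wf in auto)
  ultimately have iso': "digraph_iso (with_proj G') (with_proj cube_graph)"
    using digraph_iso_swap digraph_iso_trans iso by blast
  have V: "V\<^sub>M \<subseteq> pverts G" "V\<^sub>W \<subseteq> pverts G"
    using bip by (auto simp: is_bipartition_def)
  have adj: "(h u, h v) \<in> parcs G' \<longleftrightarrow> (u, v) \<in> parcs G" if "u \<in> pverts G" "v \<in> pverts G" for u v
  proof
    assume "(h u, h v) \<in> parcs G'"
    then obtain x y where xy: "(x, y) \<in> parcs G" "h u = h x" "h v = h y"
      by (auto simp: G'_def)
    then have "u = x" "v = y"
      using that wf inj by (auto dest: inj_onD)
    then show "(u, v) \<in> parcs G"
      using xy by simp
  qed (force simp: G'_def)
  have "is_bipartition G' (h ` V\<^sub>M) (h ` V\<^sub>W)"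
    using bip inj_on_image_Int[OF inj V]
    by (auto simp: is_bipartition_def G'_def)
  moreover have "card (h ` V\<^sub>M) = 4" "card (h ` V\<^sub>W) = 4"
    using c inj_on_subset[OF inj] V by (simp_all add: card_image)
  moreover have "bij_betw (h \<circ> \<alpha>) (men I) (h ` V\<^sub>M)" "bij_betw (h \<circ> \<beta>) (women I) (h ` V\<^sub>W)"
    using bij_betw_trans[OF \<alpha>] bij_betw_trans[OF \<beta>]
      inj_on_imp_bij_betw[OF inj_on_subset[OF inj V(1)]]
      inj_on_imp_bij_betw[OF inj_on_subset[OF inj V(2)]] by blast+
  ultimately have "strong_cube_realization I G' (h ` V\<^sub>M) (h ` V\<^sub>W) (h \<circ> \<alpha>) (h \<circ> \<beta>)"
    using iso' by (simp add: strong_cube_realization_def)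
  moreover have "nonneighbors_ranked_last I G' (h \<circ> \<alpha>) (h \<circ> \<beta>)"
  proof -
    have \<alpha>V: "\<alpha> m \<in> pverts G" if "m \<in> men I" for m
      using that \<alpha> V by (auto dest: bij_betwE)
    have \<beta>V: "\<beta> w \<in> pverts G" if "w \<in> women I" for w
      using that \<beta> V by (auto dest: bij_betwE)
    have "opposite_nonneighbor G' (h \<circ> \<beta>) (women I) ((h \<circ> \<alpha>) m) =
        opposite_nonneighbor G \<beta> (women I) (\<alpha> m)" if "m \<in> men I" for m
      using adj \<alpha>V[OF that] \<beta>V by (auto simp: opposite_nonneighbor_def intro!: arg_cong[where f = The])
    moreover have "opposite_nonneighbor G' (h \<circ> \<alpha>) (men I) ((h \<circ> \<beta>) w) =
        opposite_nonneighbor G \<alpha> (men I) (\<beta> w)" if "w \<in> women I" for w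
      using adj \<beta>V[OF that] \<alpha>V by (auto simp: opposite_nonneighbor_def intro!: arg_cong[where f = The])
    ultimately show ?thesis
      using last by (simp add: nonneighbors_ranked_last_def)
  qed
  ultimately show ?thesis
    unfolding cube_distance_compatible_def by blast
qed

end

theory Submission
  imports Defs
begin

text \<open>
  In a cube realization, non-adjacency between the two classes is a symmetric relation that pairs each
  vertex with exactly one vertex of the other class (its antipode), so it is a perfect matching; ranking
  non-neighbors last says that its pairs are mutually last-ranked.  Conversely, given a perfect matching
  of such pairs, place the men on the even-parity vertices in any way and each woman on the antipode of
  her partner.
\<close>

lemma sym_parcs_cube_graph: "sym (parcs cube_graph)"
proof -
  interpret pair_graph cube_graph
    by (rule pair_graph_cube_graph)
  show ?thesis
    using sym_arcs by (auto simp: symmetric_def arcs_ends_def arc_to_ends_def)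
qed

text \<open>A realization only provides an isomorphism with the cube, so symmetry of its arcs has to
  be pulled back. It makes being a non-neighbor mean the same seen from either class. Injectivity of
  the vertex map identifies the preimage of the reversed arc as the reversal of the given
  one.\<close>

lemma digraph_iso_sym:
  assumes iso: "digraph_iso (with_proj G) (with_proj H)" and sym: "sym (parcs H)"
  shows "sym (parcs G)"
proof (rule symI)
  fix u v assume uv: "(u, v) \<in> parcs G"
  obtain h where h: "bij_betw h (pverts G) (pverts H)"
    and arcs: "parcs H = map_prod h h ` parcs G" and wf: "parcs G \<subseteq> pverts G \<times> pverts G"
    using digraph_iso_pairD[OF iso] by metis
  have "(h v, h u) \<in> parcs H"
    using uv sym by (auto simp: arcs dest: symD)
  then obtain x y where xy: "(x, y) \<in> parcs G" "h x = h v" "h y = h u"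
    by (auto simp: arcs)
  then have "x = v" "y = u"
    using uv wf h by (auto simp: bij_betw_def dest: inj_onD)
  then show "(v, u) \<in> parcs G"
    using xy by simp
qed

lemma is_bipartition_commute: "is_bipartition G A B \<longleftrightarrow> is_bipartition G B A"
  by (auto simp: is_bipartition_def)

text \<open>Trades the definite description for a plain adjacency condition, so that non-neighbors
  taken from the two sides can be compared.\<close>

lemma opposite_nonneighbor_eq_iff:
  assumes "\<exists>!b. b \<in> B \<and> (v, g b) \<notin> parcs G"
  shows "opposite_nonneighbor G g B v = b \<longleftrightarrow> b \<in> B \<and> (v, g b) \<notin> parcs G"
  unfolding opposite_nonneighbor_def using theI'[OF assms] assms by blast

text \<open>With the cardinality of the set of differing positions unfolded into Boolean cases,
  facts about concrete vertices become finite checks.\<close>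

lemma cube_graph_arc_iff:
  "([a, b, c], [a', b', c']) \<in> parcs cube_graph \<longleftrightarrow>
    (a \<noteq> a' \<and> b = b' \<and> c = c') \<or> (a = a' \<and> b \<noteq> b' \<and> c = c') \<or> (a = a' \<and> b = b' \<and> c \<noteq> c')"
proof -
  have "{i. i < 3 \<and> [a, b, c] ! i \<noteq> [a', b', c'] ! i} =
      (if a \<noteq> a' then {0} else {}) \<union> (if b \<noteq> b' then {1} else {}) \<union> (if c \<noteq> c' then {2} else {})"
    by (auto simp: less_Suc_eq numeral_3_eq_3 numeral_2_eq_2)
  then show ?thesis
    by (simp add: cube_graph_def)
qed

definition even_vertices :: "bool list set" where
  "even_vertices =
     {[False, False, False], [False, True, True], [True, False, True], [True, True, False]}"

lemma card_even_vertices: "card even_vertices = 4"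
  by (simp add: even_vertices_def)

lemma bij_betw_map_Not: "bij_betw (map Not) A (map Not ` A)"
  by (simp add: inj_on_imp_bij_betw inj_on_def inj_map_eq_map)

text \<open>\<open>map Not\<close> is the antipodal map. It flips three bits, an odd number, so it
  carries the even class onto the odd one; an arc flips a single bit and hence also changes
  class.\<close>

lemma is_bipartition_cube_graph:
  "is_bipartition cube_graph even_vertices (map Not ` even_vertices)"
proof -
  define E where "E = even_vertices"
  define D where "D = map Not ` even_vertices"
  have verts: "E \<union> D = {x. length x = 3}"
  proof (intro set_eqI iffI)
    fix x :: "bool list" assume "x \<in> {x. length x = 3}"
    then obtain a b c where "x = [a, b, c]"
      by (auto simp: numeral_3_eq_3 length_Suc_conv)
    then show "x \<in> E \<union> D"
      by (cases a; cases b; cases c) (simp_all add: E_def D_def even_vertices_def)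
  qed (auto simp: E_def D_def even_vertices_def)
  have disjoint: "E \<inter> D = {}"
    by (simp add: E_def D_def even_vertices_def)
  have "(x, y) \<notin> parcs cube_graph" if "x \<in> E" "y \<in> E" for x y
    using that by (auto simp: E_def even_vertices_def cube_graph_arc_iff)
  moreover have "(x, y) \<notin> parcs cube_graph" if "x \<in> D" "y \<in> D" for x y
    using that by (auto simp: D_def even_vertices_def cube_graph_arc_iff)
  moreover have "parcs cube_graph \<subseteq> (E \<union> D) \<times> (E \<union> D)"
    unfolding verts by (auto simp: cube_graph_def)
  ultimately have "parcs cube_graph \<subseteq> E \<times> D \<union> D \<times> E"
    by blast
  then have "is_bipartition cube_graph E D"
    using verts disjoint by (simp add: is_bipartition_def cube_graph_def)
  then show ?thesis
    by (simp add: E_def D_def)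
qed

text \<open>Distinct even vertices differ in exactly two coordinates, so complementing one of them
  leaves a single difference, that is, an arc. Complementing \<open>x\<close> itself gives three
  differences.\<close>

lemma even_vertices_nonadjacent_iff:
  assumes "x \<in> even_vertices" "y \<in> even_vertices"
  shows "(x, map Not y) \<notin> parcs cube_graph \<longleftrightarrow> x = y"
  using assms by (auto simp: even_vertices_def cube_graph_arc_iff)

lemma mutually_last_matching_if_realization:
  assumes real: "strong_cube_realization I G V\<^sub>M V\<^sub>W \<alpha> \<beta>"
    and last: "nonneighbors_ranked_last I G \<alpha> \<beta>"
  shows "\<exists>\<pi>. bij_betw \<pi> (men I) (women I) \<and> (\<forall>m\<in>men I. mutually_last_ranked I m (\<pi> m))"
proof -
  let ?M = "men I" and ?W = "women I"
  have iso: "digraph_iso (with_proj G) (with_proj cube_graph)"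
    and bip: "is_bipartition G V\<^sub>M V\<^sub>W"
    and c: "card V\<^sub>M = 4" "card V\<^sub>W = 4"
    and \<alpha>: "bij_betw \<alpha> ?M V\<^sub>M" and \<beta>: "bij_betw \<beta> ?W V\<^sub>W"
    using real by (simp_all add: strong_cube_realization_def)
  define \<pi> where "\<pi> m = opposite_nonneighbor G \<beta> ?W (\<alpha> m)" for m
  define \<rho> where "\<rho> w = opposite_nonneighbor G \<alpha> ?M (\<beta> w)" for w
  have \<pi>: "\<pi> m = w \<longleftrightarrow> w \<in> ?W \<and> (\<alpha> m, \<beta> w) \<notin> parcs G" if "m \<in> ?M" for m w
    unfolding \<pi>_def
    by (intro opposite_nonneighbor_eq_iff ex1_nonneighbor[OF iso bip c(2) \<beta>])
      (use that \<alpha> in \<open>auto dest: bij_betwE\<close>)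
  \<comment> \<open>The women's side is the same argument with the two classes exchanged.\<close>
  have \<rho>: "\<rho> w = m \<longleftrightarrow> m \<in> ?M \<and> (\<beta> w, \<alpha> m) \<notin> parcs G" if "w \<in> ?W" for m w
    unfolding \<rho>_def
    by (intro opposite_nonneighbor_eq_iff
        ex1_nonneighbor[OF iso bip[unfolded is_bipartition_commute[of G V\<^sub>M]] c(1) \<alpha>])
      (use that \<beta> in \<open>auto dest: bij_betwE\<close>)
  have \<pi>W: "\<pi> m \<in> ?W" if "m \<in> ?M" for m
    using \<pi>[OF that] by blast
  have \<rho>M: "\<rho> w \<in> ?M" if "w \<in> ?W" for w
    using \<rho>[OF that] by blast
  \<comment> \<open>The two sides say that \<open>(\<alpha> m, \<beta> w)\<close> and
    \<open>(\<beta> w, \<alpha> m)\<close>, respectively, are not arcs; symmetry of \<open>G\<close>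
    identifies these.\<close>
  have inverse: "\<pi> m = w \<longleftrightarrow> \<rho> w = m" if "m \<in> ?M" "w \<in> ?W" for m w
    using \<pi> \<rho> that symD[OF digraph_iso_sym[OF iso sym_parcs_cube_graph]] by blast
  have "bij_betw \<pi> ?M ?W"
    by (rule bij_betw_byWitness[where f' = \<rho>]) (use inverse \<pi>W \<rho>M in auto)
  moreover have "mutually_last_ranked I m (\<pi> m)" if m: "m \<in> ?M" for m
  proof -
    have "\<rho> (\<pi> m) = m"
      using inverse m \<pi>W by blast
    \<comment> \<open>The hypothesis for the woman \<open>\<pi> m\<close> speaks of her own
      non-neighbor \<open>\<rho> (\<pi> m)\<close>, which has just been identified as
      \<open>m\<close>.\<close>
    then have "ranked_last ?M (pref_w I (\<pi> m)) m"
      using last \<pi>W[OF m] by (metis nonneighbors_ranked_last_def \<rho>_def)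
    then show ?thesis
      using last m \<pi>W[OF m] by (simp add: mutually_last_ranked_def nonneighbors_ranked_last_def \<pi>_def)
  qed
  ultimately show ?thesis
    by blast
qed

lemma cube_distance_compatible_if_matching:
  assumes card: "card (men I) = 4"
    and \<pi>: "bij_betw \<pi> (men I) (women I)"
    and mutual: "\<And>m. m \<in> men I \<Longrightarrow> mutually_last_ranked I m (\<pi> m)"
  shows "cube_distance_compatible I"
proof -
  let ?M = "men I" and ?W = "women I" and ?E = even_vertices and ?O = "map Not ` even_vertices"
  \<comment> \<open>Both sets have cardinality four; as this is positive, it also yields their
    finiteness.\<close>
  obtain \<alpha> where \<alpha>: "bij_betw \<alpha> ?M ?E"
    using finite_same_card_bij[of ?M ?E] card card_even_vertices card_ge_0_finite[of ?M]
      card_ge_0_finite[of ?E] by auto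
  define \<rho> where "\<rho> = inv_into ?M \<pi>"
  define \<beta> where "\<beta> = map Not \<circ> (\<alpha> \<circ> \<rho>)"
  have \<rho>: "bij_betw \<rho> ?W ?M"
    unfolding \<rho>_def by (rule bij_betw_inv_into[OF \<pi>])
  have \<rho>M: "\<rho> w \<in> ?M" and \<pi>\<rho>: "\<pi> (\<rho> w) = w" if "w \<in> ?W" for w
    using that \<rho> bij_betw_inv_into_right[OF \<pi>] by (auto simp: \<rho>_def dest: bij_betwE)
  have \<rho>\<pi>: "\<rho> (\<pi> m) = m" and \<pi>W: "\<pi> m \<in> ?W" if "m \<in> ?M" for m
    using that \<pi> bij_betw_inv_into_left[OF \<pi>] by (auto simp: \<rho>_def dest: bij_betwE)
  have \<beta>: "bij_betw \<beta> ?W ?O"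
    unfolding \<beta>_def by (intro bij_betw_trans[OF _ bij_betw_map_Not] bij_betw_trans[OF \<rho> \<alpha>])
  have real: "strong_cube_realization I cube_graph ?E ?O \<alpha> \<beta>"
    unfolding strong_cube_realization_def
  proof (intro conjI is_bipartition_cube_graph card_even_vertices \<alpha> \<beta>)
    show "digraph_iso (with_proj cube_graph) (with_proj cube_graph)"
      by (rule digraph_iso_pairI[of id]) (auto simp: cube_graph_def map_prod.id)
    show "card ?O = 4"
      using bij_betw_same_card[OF bij_betw_map_Not] card_even_vertices by metis
  qed
  \<comment> \<open>The vertex \<open>\<beta> w\<close> is the antipode of
    \<open>\<alpha> (\<rho> w)\<close>, so non-adjacency forces equality of two even vertices, and
    injectivity of \<open>\<alpha>\<close> turns this into equality of men.\<close>
  have nonadj: "(\<alpha> m, \<beta> w) \<notin> parcs cube_graph \<longleftrightarrow> w = \<pi> m" if "m \<in> ?M" "w \<in> ?W" for m w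
  proof -
    have "(\<alpha> m, \<beta> w) \<notin> parcs cube_graph \<longleftrightarrow> \<alpha> m = \<alpha> (\<rho> w)"
      unfolding \<beta>_def comp_apply
      by (rule even_vertices_nonadjacent_iff) (use that \<alpha> \<rho>M in \<open>auto dest: bij_betwE\<close>)
    also have "\<dots> \<longleftrightarrow> m = \<rho> w"
      using that \<alpha> \<rho>M by (auto simp: bij_betw_def dest: inj_onD)
    also have "\<dots> \<longleftrightarrow> w = \<pi> m"
      using that \<rho>\<pi> \<pi>\<rho> by auto
    finally show ?thesis .
  qed
  have nonadj': "(\<beta> w, \<alpha> m) \<notin> parcs cube_graph \<longleftrightarrow> m = \<rho> w" if "m \<in> ?M" "w \<in> ?W" for m w
    using nonadj[OF that] that \<rho>\<pi> \<pi>\<rho> symD[OF sym_parcs_cube_graph] by metis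
  have "opposite_nonneighbor cube_graph \<beta> ?W (\<alpha> m) = \<pi> m" if "m \<in> ?M" for m
    unfolding opposite_nonneighbor_def by (rule the_equality) (use that nonadj \<pi>W in auto)
  moreover have "opposite_nonneighbor cube_graph \<alpha> ?M (\<beta> w) = \<rho> w" if "w \<in> ?W" for w
    unfolding opposite_nonneighbor_def by (rule the_equality) (use that nonadj' \<rho>M in auto)
  \<comment> \<open>Mutuality is assumed man by man; applied to \<open>\<rho> w\<close> it reaches
    every woman, since \<open>\<pi>\<close> maps her partner back to her.\<close>
  moreover have "ranked_last ?M (pref_w I w) (\<rho> w)" if "w \<in> ?W" for w
    using mutual[OF \<rho>M[OF that]] \<pi>\<rho>[OF that] by (simp add: mutually_last_ranked_def)
  ultimately have "nonneighbors_ranked_last I cube_graph \<alpha> \<beta>"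
    using mutual by (simp add: nonneighbors_ranked_last_def mutually_last_ranked_def)
  \<comment> \<open>The realization lives on Boolean lists, whereas compatibility asks for natural
    numbers as vertices; \<open>cube_distance_compatibleI\<close> transfers it.\<close>
  then show ?thesis
    using real by (rule cube_distance_compatibleI[rotated])
qed

theorem proposition7p3:
  fixes I :: "'a preference_structure"
  assumes "complete_bipartite_preference_structure 4 I"
  shows "cube_distance_compatible I \<longleftrightarrow>
    (\<exists>\<pi>. bij_betw \<pi> (men I) (women I) \<and> (\<forall>m\<in>men I. mutually_last_ranked I m (\<pi> m)))"
proof
  assume "cube_distance_compatible I"
  then show "\<exists>\<pi>. bij_betw \<pi> (men I) (women I) \<and> (\<forall>m\<in>men I. mutually_last_ranked I m (\<pi> m))"
    unfolding cube_distance_compatible_def by (blast intro: mutually_last_matching_if_realization)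
next
  assume "\<exists>\<pi>. bij_betw \<pi> (men I) (women I) \<and> (\<forall>m\<in>men I. mutually_last_ranked I m (\<pi> m))"
  moreover have "card (men I) = 4"
    using assms by (simp add: complete_bipartite_preference_structure_def)
  ultimately show "cube_distance_compatible I"
    using cube_distance_compatible_if_matching by blast
qed

end
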